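(* Let $G$ be an amenable graph with a transitive automorphism group $\Gamma\subset\mathrm{Aut}(G)$, and let $\omega$ be a $\Gamma$-invariant percolation on $G$. Then almost surely every component of $\omega$ is in $\mathcal{O}_{\mathbf{HD}}$.
   Context: Graphs $G$ are connected and locally finite. $G$ is amenable if there are finite sets $V_1\subset V_2\subset\cdots\subset V(G)$ with $\bigcup_n V_n=V(G)$ and $|\partial_E V_n|/|V_n|\to0$, where $\partial_E V_n$ is the set of edges of $G$ with exactly one endpoint in $V_n$. $\Gamma$ is transitive if it acts transitively on $V(G)$. A percolation on $G$ is a random subgraph of $G$, given by a probability measure on $2^{V(G)\cup E(G)}$ (with the product $\sigma$-field) supported on subgraphs of $G$; bond percolations (random subsets of $E(G)$, identified with the subgraph having all vertices of $G$) and site percolations (random subsets of $V(G)$, identified with the induced subgraph) are included. It is $\Gamma$-invariant if its law is invariant under each element of $\Gamma$. For a connected locally finite graph $H$, a function $F:V(H)\to\mathbb{R}$ is harmonic if $F(x)=\sum_{y\sim x}F(y)/\deg_H x$ for all $x\in V(H)$, and Dirichlet if $\sum_x\sum_{y\sim x}|F(x)-F(y)|^2<\infty$. $\mathcal{O}_{\mathbf{HD}}$ is the class of graphs that admit no nonconstant harmonic Dirichlet functions (a single-vertex graph belongs to the class trivially). *)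

theory Defs
  imports "HOL-Probability.Probability" "HOL-Algebra.Bij"
begin

text \<open>Simple undirected graphs, possibly infinite; an edge is the two-element set of its
  endpoints.\<close>

record 'a ugraph =
  verts :: "'a set"
  edges :: "'a set set"

definition is_graph :: "'a ugraph \<Rightarrow> bool" where
  "is_graph G \<longleftrightarrow> (\<forall>e\<in>edges G. e \<subseteq> verts G \<and> card e = 2)"

definition nbrs :: "'a ugraph \<Rightarrow> 'a \<Rightarrow> 'a set" where
  "nbrs G x = {y \<in> verts G. {x, y} \<in> edges G}"

definition deg :: "'a ugraph \<Rightarrow> 'a \<Rightarrow> nat" where
  "deg G x = card (nbrs G x)"

definition locally_finite :: "'a ugraph \<Rightarrow> bool" where
  "locally_finite G \<longleftrightarrow> (\<forall>x\<in>verts G. finite (nbrs G x))"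

definition reachable :: "'a ugraph \<Rightarrow> 'a \<Rightarrow> 'a \<Rightarrow> bool" where
  "reachable G x y \<longleftrightarrow> (x, y) \<in> {(u, v). {u, v} \<in> edges G}\<^sup>*"

definition connected_graph :: "'a ugraph \<Rightarrow> bool" where
  "connected_graph G \<longleftrightarrow> verts G \<noteq> {} \<and> (\<forall>x\<in>verts G. \<forall>y\<in>verts G. reachable G x y)"

definition component_of :: "'a ugraph \<Rightarrow> 'a \<Rightarrow> 'a ugraph" where
  "component_of G x =
     \<lparr>verts = {y \<in> verts G. reachable G x y},
      edges = {e \<in> edges G. \<forall>y\<in>e. reachable G x y}\<rparr>"

definition components_of :: "'a ugraph \<Rightarrow> 'a ugraph set" where
  "components_of G = component_of G ` verts G"

definition edge_boundary :: "'a ugraph \<Rightarrow> 'a set \<Rightarrow> 'a set set" where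
  "edge_boundary G A = {e \<in> edges G. card (e \<inter> A) = 1}"

text \<open>The sequence is only required to be weakly increasing, so finite graphs are amenable.\<close>

definition amenable_graph :: "'a ugraph \<Rightarrow> bool" where
  "amenable_graph G \<longleftrightarrow>
     (\<exists>W :: nat \<Rightarrow> 'a set.
        (\<forall>n. finite (W n) \<and> W n \<subseteq> verts G) \<and> incseq W \<and> (\<Union>n. W n) = verts G \<and>
        (\<lambda>n. real (card (edge_boundary G (W n))) / real (card (W n))) \<longlonglongrightarrow> 0)"

definition graph_auts :: "'a ugraph \<Rightarrow> ('a \<Rightarrow> 'a) set" where
  "graph_auts G = {\<gamma> \<in> Bij (verts G).
     \<forall>x\<in>verts G. \<forall>y\<in>verts G. {\<gamma> x, \<gamma> y} \<in> edges G \<longleftrightarrow> {x, y} \<in> edges G}"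

definition aut_group :: "'a ugraph \<Rightarrow> ('a \<Rightarrow> 'a) monoid" where
  "aut_group G = BijGroup (verts G)\<lparr>carrier := graph_auts G\<rparr>"

definition transitive_on_verts :: "'a ugraph \<Rightarrow> ('a \<Rightarrow> 'a) set \<Rightarrow> bool" where
  "transitive_on_verts G \<Gamma> \<longleftrightarrow> (\<forall>x\<in>verts G. \<forall>y\<in>verts G. \<exists>\<gamma>\<in>\<Gamma>. \<gamma> x = y)"

text \<open>A configuration is an indicator function on the disjoint union of the vertices and the
  edges, extensional, so configurations correspond exactly to subsets.\<close>

type_synonym 'a config = "'a + 'a set \<Rightarrow> bool"

definition config_space :: "'a ugraph \<Rightarrow> 'a config measure" where
  "config_space G = PiM (verts G <+> edges G) (\<lambda>_. count_space UNIV)"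

definition config_graph :: "'a ugraph \<Rightarrow> 'a config \<Rightarrow> 'a ugraph" where
  "config_graph G \<omega> =
     \<lparr>verts = {v \<in> verts G. \<omega> (Inl v)}, edges = {e \<in> edges G. \<omega> (Inr e)}\<rparr>"

text \<open>A percolation is represented by its law. Elements of \<^const>\<open>config_space\<close> may contain an
  edge without its endpoints; \<^const>\<open>is_graph\<close> excludes these almost surely.\<close>

definition percolation :: "'a ugraph \<Rightarrow> 'a config measure \<Rightarrow> bool" where
  "percolation G \<mu> \<longleftrightarrow>
     prob_space \<mu> \<and> sets \<mu> = sets (config_space G) \<and> (AE \<omega> in \<mu>. is_graph (config_graph G \<omega>))"

text \<open>The image of a configuration under \<open>\<gamma>\<close>: a vertex or edge lies in it iff its preimage
  under \<open>\<gamma>\<close> lies in \<open>\<omega>\<close>.\<close>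

definition config_image :: "'a ugraph \<Rightarrow> ('a \<Rightarrow> 'a) \<Rightarrow> 'a config \<Rightarrow> 'a config" where
  "config_image G \<gamma> \<omega> =
     (let \<delta> = inv_into (verts G) \<gamma>
      in (\<lambda>z \<in> verts G <+> edges G. \<omega> (map_sum \<delta> (image \<delta>) z)))"

definition invariant_percolation ::
    "'a ugraph \<Rightarrow> ('a \<Rightarrow> 'a) set \<Rightarrow> 'a config measure \<Rightarrow> bool" where
  "invariant_percolation G \<Gamma> \<mu> \<longleftrightarrow>
     percolation G \<mu> \<and> (\<forall>\<gamma>\<in>\<Gamma>. distr \<mu> (config_space G) (config_image G \<gamma>) = \<mu>)"

text \<open>Functions on \<^term>\<open>verts H\<close> are total functions of which only the values on
  \<^term>\<open>verts H\<close> matter. At an isolated vertex division by zero makes the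
  harmonicity equation read \<open>F x = 0\<close>; in a connected graph this concerns only the
  single-vertex graph, on which every function is constant anyway.\<close>

definition harmonic :: "'a ugraph \<Rightarrow> ('a \<Rightarrow> real) \<Rightarrow> bool" where
  "harmonic H F \<longleftrightarrow> (\<forall>x\<in>verts H. F x = (\<Sum>y\<in>nbrs H x. F y / real (deg H x)))"

definition dirichlet :: "'a ugraph \<Rightarrow> ('a \<Rightarrow> real) \<Rightarrow> bool" where
  "dirichlet H F \<longleftrightarrow> (\<lambda>x. \<Sum>y\<in>nbrs H x. \<bar>F x - F y\<bar>\<^sup>2) summable_on verts H"

definition O_HD :: "'a ugraph set" where
  "O_HD = {H. is_graph H \<and> connected_graph H \<and> locally_finite H \<and>
     \<not> (\<exists>F. harmonic H F \<and> dirichlet H F \<and> \<not> F constant_on verts H)}"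

end

theory Submission
  imports Defs
begin

text \<open>
  Why the theorem is true. Let \<open>A\<close> be the adjacency relation of the random subgraph. For a
  finite set \<open>V\<close> of vertices and \<open>x \<in> V\<close>, consider the functions \<open>F\<close> that are harmonic for \<open>A\<close>
  at every vertex of \<open>V\<close> and whose energy on the edges issuing from \<open>V\<close> is at most \<open>1\<close>, and ask
  how much of this energy can sit on the edges at \<open>x\<close>; the supremum is \<open>harmonic_share_in A V x\<close>.
  Its infimum over all \<open>V\<close>, \<open>harmonic_share A X x\<close>, is positive at some \<open>x\<close> as soon as some
  component carries a nonconstant harmonic Dirichlet function, because such a function, extended
  by \<open>0\<close> to the other components and normalized, competes for every \<open>V\<close> at once
  (\<open>harmonic_share_pos\<close>, \<open>component_in_O_HD\<close>). So it suffices that all shares vanish almost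
  surely.

  Inside a fixed \<open>V\<close> the shares have a small sum, by a dimension count. The gradients, on
  the edges issuing from \<open>V\<close>, of functions harmonic on \<open>V\<close> form a linear space, and such a
  gradient is determined by the values of the function on the outer vertex boundary of \<open>V\<close>
  (\<open>harmonic_zero_outside\<close>). The share of \<open>x\<close> is at most the trace of the orthogonal projection
  onto this space over the edges at \<open>x\<close>, so the shares sum to at most the dimension of the
  space, hence to at most \<open>\<bar>\<partial>\<^sub>E V\<bar>\<close> (\<open>coordinate_weights\<close>, \<open>sum_harmonic_share_in_le\<close>,
  \<open>sum_harmonic_share_le_boundary\<close>).

  The share is defined without reference to any labelling of the vertices and is measurable, since
  each \<open>V\<close> involves only finitely many coordinates of the configuration. By invariance and
  transitivity its expectation is therefore a constant \<open>c\<close> independent of \<open>x\<close>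
  (\<open>expected_harmonic_share_le\<close>). Summation over a Foelner set gives \<open>c \<bar>V\<^sub>n\<bar> \<le> \<bar>\<partial>\<^sub>E V\<^sub>n\<bar>\<close>, and
  amenability forces \<open>c = 0\<close> (\<open>AE_harmonic_share_zero\<close>).
\<close>

section \<open>Spaces of functions determined by finitely many values\<close>

text \<open>The functionals \<open>d e\<close> map \<open>S\<close> to a space of vectors indexed by \<open>E\<close>. If these vectors depend
  only on the values on \<open>B\<close>, the image has dimension at most \<open>\<bar>B\<bar>\<close> and so has an orthonormal basis
  of at most that size; \<open>U\<close> consists of preimages of such a basis. Evaluations at the points of
  \<open>B\<close> are removed one at a time: the functions vanishing at \<open>b\<close> have codimension at most one.\<close>

lemma orthonormal_spanning_set:
  fixes d :: "'e \<Rightarrow> ('a \<Rightarrow> real) \<Rightarrow> real"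
  assumes "finite B" and fE: "finite E"
    and lin: "\<And>e F G c. e \<in> E \<Longrightarrow> d e (\<lambda>x. F x + c * G x) = d e F + c * d e G"
    and add: "\<And>F G c. F \<in> S \<Longrightarrow> G \<in> S \<Longrightarrow> (\<lambda>x. F x + c * G x) \<in> S"
    and det: "\<And>F e. F \<in> S \<Longrightarrow> (\<forall>b\<in>B. F b = 0) \<Longrightarrow> e \<in> E \<Longrightarrow> d e F = 0"
  shows "\<exists>U. finite U \<and> card U \<le> card B \<and> U \<subseteq> S \<and>
           (\<forall>u\<in>U. \<forall>v\<in>U. (\<Sum>e\<in>E. d e u * d e v) = (if u = v then 1 else 0)) \<and>
           (\<forall>F\<in>S. \<exists>a. \<forall>e\<in>E. d e F = (\<Sum>u\<in>U. a u * d e u))"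
  using assms(1) add det
proof (induction B arbitrary: S rule: finite_induct)
  case empty
  show ?case
    by (rule exI[of _ "{}"]) (use empty in auto)
next
  case (insert b B)
  define T where "T = {F \<in> S. F b = 0}"
  have "\<exists>U. finite U \<and> card U \<le> card B \<and> U \<subseteq> T \<and>
           (\<forall>u\<in>U. \<forall>v\<in>U. (\<Sum>e\<in>E. d e u * d e v) = (if u = v then 1 else 0)) \<and>
           (\<forall>F\<in>T. \<exists>a. \<forall>e\<in>E. d e F = (\<Sum>u\<in>U. a u * d e u))"
    using insert.prems by (intro insert.IH) (auto simp: T_def)
  then obtain U where U: "finite U" "card U \<le> card B" "U \<subseteq> T"
      and on: "\<And>u v. u \<in> U \<Longrightarrow> v \<in> U \<Longrightarrow> (\<Sum>e\<in>E. d e u * d e v) = (if u = v then 1 else 0)"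
      and sp: "\<And>F. F \<in> T \<Longrightarrow> \<exists>a. \<forall>e\<in>E. d e F = (\<Sum>u\<in>U. a u * d e u)"
    by (elim exE conjE) blast
  have US: "U \<subseteq> S" using U(3) by (auto simp: T_def)
  show ?case
  proof (cases "S = T")
    case True
    show ?thesis
      using U US on sp True insert.hyps by (intro exI[of _ U]) auto
  next
    case False
    then obtain F0 where F0: "F0 \<in> S" "F0 b \<noteq> 0" by (auto simp: T_def)
    \<comment> \<open>Gram--Schmidt; the value at \<open>b\<close> survives because the members of \<open>U\<close> vanish there.\<close>
    have proj: "\<exists>v\<in>S. v b = F0 b \<and> (\<forall>e\<in>E. d e v = d e F0 - (\<Sum>u\<in>W. c u * d e u))"
      if "finite W" "W \<subseteq> U" for W c
      using that
    proof (induction W rule: finite_induct)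
      case empty
      then show ?case using F0 by auto
    next
      case (insert w W)
      then obtain v where v: "v \<in> S" "v b = F0 b"
          "\<And>e. e \<in> E \<Longrightarrow> d e v = d e F0 - (\<Sum>u\<in>W. c u * d e u)"
        by auto
      have w: "w \<in> S" "w b = 0" using insert.prems U(3) by (auto simp: T_def)
      show ?case
        using \<open>\<And>F G c. F \<in> S \<Longrightarrow> G \<in> S \<Longrightarrow> (\<lambda>x. F x + c * G x) \<in> S\<close>[OF v(1) w(1), of "- c w"]
          v(2,3) w(2) insert.hyps lin[where F=v and G=w and c="- c w"]
        by (intro bexI[of _ "\<lambda>x. v x + (- c w) * w x"]) auto
    qed
    obtain v where v: "v \<in> S" "v b = F0 b"
        and dv: "\<And>e. e \<in> E \<Longrightarrow> d e v = d e F0 - (\<Sum>u\<in>U. (\<Sum>e\<in>E. d e F0 * d e u) * d e u)"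
      using proj[OF U(1) subset_refl, of "\<lambda>u. \<Sum>e\<in>E. d e F0 * d e u"] by blast
    have orth: "(\<Sum>e\<in>E. d e v * d e w) = 0" if "w \<in> U" for w
    proof -
      have "(\<Sum>e\<in>E. d e v * d e w) =
          (\<Sum>e\<in>E. d e F0 * d e w - (\<Sum>u\<in>U. (\<Sum>e\<in>E. d e F0 * d e u) * (d e u * d e w)))"
        by (intro sum.cong) (simp_all add: dv left_diff_distrib sum_distrib_right mult.assoc)
      also have "\<dots> = (\<Sum>e\<in>E. d e F0 * d e w) -
          (\<Sum>u\<in>U. (\<Sum>e\<in>E. d e F0 * d e u) * (\<Sum>e\<in>E. d e u * d e w))"
        unfolding sum_subtractf by (subst sum.swap) (simp add: sum_distrib_left)
      also have "(\<Sum>u\<in>U. (\<Sum>e\<in>E. d e F0 * d e u) * (\<Sum>e\<in>E. d e u * d e w)) =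
          (\<Sum>u\<in>U. if u = w then (\<Sum>e\<in>E. d e F0 * d e u) else 0)"
        by (intro sum.cong) (simp_all add: on that)
      also have "\<dots> = (\<Sum>e\<in>E. d e F0 * d e w)"
        using U(1) that by simp
      finally show ?thesis by simp
    qed
    define N where "N = (\<Sum>e\<in>E. d e v * d e v)"
    have split: "\<exists>a. \<forall>e\<in>E. d e F = (F b / v b) * d e v + (\<Sum>u\<in>U. a u * d e u)" if "F \<in> S" for F
    proof -
      let ?c = "F b / v b"
      have "(\<lambda>x. F x + (- ?c) * v x) \<in> T"
        using insert.prems(1)[OF that v(1), of "- ?c"] F0 v(2) by (simp add: T_def)
      from sp[OF this] obtain a where
        "\<And>e. e \<in> E \<Longrightarrow> d e (\<lambda>x. F x + (- ?c) * v x) = (\<Sum>u\<in>U. a u * d e u)" by blast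
      then show ?thesis
        using lin[where F=F and G=v and c="- ?c"] by (intro exI[of _ a]) force
    qed
    \<comment> \<open>\<open>v\<close> is nonzero as a function, but its image under \<open>d\<close> may vanish; then \<open>U\<close> already spans.\<close>
    show ?thesis
    proof (cases "N = 0")
      case True
      then have "d e v = 0" if "e \<in> E" for e
        using that fE by (simp add: N_def sum_nonneg_eq_0_iff)
      then show ?thesis
        using U US on split insert.hyps by (intro exI[of _ U]) auto
    next
      case False
      moreover have "N \<ge> 0" by (simp add: N_def sum_nonneg)
      ultimately have Np: "N > 0" by simp
      have "(\<lambda>x. v x + (1 / sqrt N - 1) * v x) \<in> S"
        by (rule insert.prems(1)[OF v(1) v(1)])
      then obtain v' where v': "v' \<in> S" and dv': "\<And>e. e \<in> E \<Longrightarrow> d e v' = d e v / sqrt N"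
        using lin[where F=v and G=v and c="1 / sqrt N - 1"] by (auto simp: algebra_simps)
      have nv': "(\<Sum>e\<in>E. d e v' * d e v') = 1"
      proof -
        have "(\<Sum>e\<in>E. d e v' * d e v') = (\<Sum>e\<in>E. (d e v * d e v) / N)"
          using Np by (intro sum.cong) (simp_all add: dv')
        also have "\<dots> = 1" using Np by (simp add: sum_divide_distrib[symmetric] N_def)
        finally show ?thesis .
      qed
      have ov': "(\<Sum>e\<in>E. d e v' * d e w) = 0" if "w \<in> U" for w
      proof -
        have "(\<Sum>e\<in>E. d e v' * d e w) = (\<Sum>e\<in>E. (d e v * d e w) / sqrt N)"
          by (intro sum.cong) (simp_all add: dv')
        then show ?thesis using orth[OF that] by (simp add: sum_divide_distrib[symmetric])
      qed
      have ov'': "(\<Sum>e\<in>E. d e w * d e v') = 0" if "w \<in> U" for w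
        using ov'[OF that] by (simp add: mult.commute)
      have nin: "v' \<notin> U" using nv' ov' by fastforce
      have "\<exists>a. \<forall>e\<in>E. d e F = (\<Sum>u\<in>insert v' U. a u * d e u)" if FS: "F \<in> S" for F
      proof -
        obtain a where a: "\<And>e. e \<in> E \<Longrightarrow> d e F = (F b / v b) * d e v + (\<Sum>u\<in>U. a u * d e u)"
          using split[OF FS] by blast
        have "(\<Sum>u\<in>U. (a(v' := (F b / v b) * sqrt N)) u * d e u) = (\<Sum>u\<in>U. a u * d e u)" for e
          using nin by (intro sum.cong) auto
        then show ?thesis
          using a dv' Np nin U(1)
          by (intro exI[of _ "a(v' := (F b / v b) * sqrt N)"]) auto
      qed
      then show ?thesis
        using U US v' nv' ov' ov'' on nin insert.hyps
        by (intro exI[of _ "insert v' U"]) auto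
    qed
  qed
qed

text \<open>The weight \<open>w e\<close> is the diagonal entry at \<open>e\<close> of the orthogonal projection onto the image
  of \<open>S\<close>. By Cauchy--Schwarz it bounds the squared \<open>e\<close>-th coordinate of every unit vector
  of the image, and the sum of the weights is the trace, that is, the dimension.\<close>

lemma coordinate_weights:
  fixes d :: "'e \<Rightarrow> ('a \<Rightarrow> real) \<Rightarrow> real"
  assumes "finite B" and fE: "finite E"
    and lin: "\<And>e F G c. e \<in> E \<Longrightarrow> d e (\<lambda>x. F x + c * G x) = d e F + c * d e G"
    and add: "\<And>F G c. F \<in> S \<Longrightarrow> G \<in> S \<Longrightarrow> (\<lambda>x. F x + c * G x) \<in> S"
    and det: "\<And>F e. F \<in> S \<Longrightarrow> (\<forall>b\<in>B. F b = 0) \<Longrightarrow> e \<in> E \<Longrightarrow> d e F = 0"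
  shows "\<exists>w. (\<forall>e\<in>E. 0 \<le> w e) \<and> (\<Sum>e\<in>E. w e) \<le> real (card B) \<and>
           (\<forall>F\<in>S. \<forall>e\<in>E. (d e F)\<^sup>2 \<le> w e * (\<Sum>e\<in>E. (d e F)\<^sup>2))"
proof -
  have "\<exists>U. finite U \<and> card U \<le> card B \<and> U \<subseteq> S \<and>
           (\<forall>u\<in>U. \<forall>v\<in>U. (\<Sum>e\<in>E. d e u * d e v) = (if u = v then 1 else 0)) \<and>
           (\<forall>F\<in>S. \<exists>a. \<forall>e\<in>E. d e F = (\<Sum>u\<in>U. a u * d e u))"
    using assms(1,2) by (rule orthonormal_spanning_set) (fact lin add det)+
  then obtain U where U: "finite U" "card U \<le> card B"
      and on: "\<And>u v. u \<in> U \<Longrightarrow> v \<in> U \<Longrightarrow> (\<Sum>e\<in>E. d e u * d e v) = (if u = v then 1 else 0)"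
      and sp: "\<And>F. F \<in> S \<Longrightarrow> \<exists>a. \<forall>e\<in>E. d e F = (\<Sum>u\<in>U. a u * d e u)"
    by (elim exE conjE) blast
  define w where "w e = (\<Sum>u\<in>U. (d e u)\<^sup>2)" for e
  have "(\<Sum>e\<in>E. w e) = (\<Sum>u\<in>U. \<Sum>e\<in>E. d e u * d e u)"
    unfolding w_def by (subst sum.swap) (simp add: power2_eq_square)
  also have "\<dots> = real (card U)" by (simp add: on)
  finally have tr: "(\<Sum>e\<in>E. w e) \<le> real (card B)" using U(2) by simp
  have "(d e F)\<^sup>2 \<le> w e * (\<Sum>e\<in>E. (d e F)\<^sup>2)" if F: "F \<in> S" and e: "e \<in> E" for F e
  proof -
    obtain a where a: "\<And>e. e \<in> E \<Longrightarrow> d e F = (\<Sum>u\<in>U. a u * d e u)" using sp[OF F] by blast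
    have "(\<Sum>e\<in>E. (d e F)\<^sup>2) = (\<Sum>e\<in>E. \<Sum>u\<in>U. \<Sum>v\<in>U. (a u * a v) * (d e u * d e v))"
      by (intro sum.cong) (simp_all add: a power2_eq_square sum_product algebra_simps)
    also have "\<dots> = (\<Sum>u\<in>U. \<Sum>v\<in>U. \<Sum>e\<in>E. (a u * a v) * (d e u * d e v))"
      by (subst sum.swap, intro sum.cong refl, rule sum.swap)
    also have "\<dots> = (\<Sum>u\<in>U. \<Sum>v\<in>U. if u = v then a u * a v else 0)"
      by (intro sum.cong) (simp_all add: sum_distrib_left[symmetric] on)
    also have "\<dots> = (\<Sum>u\<in>U. (a u)\<^sup>2)"
      using U(1) by (simp add: power2_eq_square)
    finally have "(\<Sum>e\<in>E. (d e F)\<^sup>2) = (\<Sum>u\<in>U. (a u)\<^sup>2)" .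
    moreover have "(\<Sum>u\<in>U. a u * d e u)\<^sup>2 \<le> (\<Sum>u\<in>U. (a u)\<^sup>2) * (\<Sum>u\<in>U. (d e u)\<^sup>2)"
      by (rule Cauchy_Schwarz_ineq_sum)
    ultimately show ?thesis using a[OF e] by (simp add: w_def mult.commute)
  qed
  then show ?thesis using tr by (intro exI[of _ w]) (auto simp: w_def sum_nonneg)
qed

section \<open>Local energy of harmonic functions\<close>

text \<open>Graphs enter only through their adjacency relation \<open>A\<close>. Energies are summed over ordered pairs
  of adjacent vertices, so that an edge inside \<open>V\<close> counts twice, as in \<^const>\<open>dirichlet\<close>, and
  an edge leaving \<open>V\<close> once.\<close>

definition star_energy :: "('a \<Rightarrow> 'a \<Rightarrow> bool) \<Rightarrow> ('a \<Rightarrow> real) \<Rightarrow> 'a \<Rightarrow> real" where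
  "star_energy A F x = (\<Sum>y | A x y. (F x - F y)\<^sup>2)"

text \<open>Vanishing of the Laplacian; without the division by the degree, the condition is meaningful
  at isolated vertices, where it holds for every function.\<close>

definition harmonic_at :: "('a \<Rightarrow> 'a \<Rightarrow> bool) \<Rightarrow> ('a \<Rightarrow> real) \<Rightarrow> 'a \<Rightarrow> bool" where
  "harmonic_at A F x \<longleftrightarrow> (\<Sum>y | A x y. F x - F y) = 0"

definition normalized_harmonic :: "('a \<Rightarrow> 'a \<Rightarrow> bool) \<Rightarrow> 'a set \<Rightarrow> ('a \<Rightarrow> real) set" where
  "normalized_harmonic A V =
     {F. (\<forall>x\<in>V. harmonic_at A F x) \<and> (\<Sum>x\<in>V. star_energy A F x) \<le> 1}"

definition harmonic_share_in :: "('a \<Rightarrow> 'a \<Rightarrow> bool) \<Rightarrow> 'a set \<Rightarrow> 'a \<Rightarrow> ennreal" where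
  "harmonic_share_in A V x = (SUP F \<in> normalized_harmonic A V. ennreal (star_energy A F x))"

text \<open>Taking the infimum over all finite sets makes the share local enough to be measurable and
  equivariant under every automorphism, and at most the share in whichever \<open>V\<close> is at hand.\<close>

definition harmonic_share :: "('a \<Rightarrow> 'a \<Rightarrow> bool) \<Rightarrow> 'a set \<Rightarrow> 'a \<Rightarrow> ennreal" where
  "harmonic_share A X x = (INF V \<in> {V. finite V \<and> V \<subseteq> X \<and> x \<in> V}. harmonic_share_in A V x)"

lemma star_energy_nonneg: "0 \<le> star_energy A F x"
  by (simp add: star_energy_def sum_nonneg)

text \<open>Uniqueness for the Dirichlet problem. Summation by parts: the energy of \<open>F\<close> equals
  twice the sum of \<open>F x\<close> times the Laplacian of \<open>F\<close> at \<open>x\<close>, and in each term one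
  factor vanishes.\<close>

lemma harmonic_zero_outside:
  assumes sym: "\<And>x y. A x y \<Longrightarrow> A y x" and fV: "finite V"
    and lf: "\<And>x. x \<in> V \<Longrightarrow> finite {y. A x y}"
    and har: "\<And>x. x \<in> V \<Longrightarrow> harmonic_at A F x"
    and zero: "\<And>x y. x \<in> V \<Longrightarrow> y \<notin> V \<Longrightarrow> A x y \<Longrightarrow> F y = 0"
    and xy: "x \<in> V" "A x y"
  shows "F x = F y"
proof -
  define T where "T = V \<union> (\<Union>x\<in>V. {y. A x y})"
  have fT: "finite T" using fV lf by (auto simp: T_def)
  have FT: "F x = 0" if "x \<in> T - V" for x using that zero by (auto simp: T_def)
  define a where "a x y = (if A x y then 1 else 0 :: real)" for x y
  have asym: "a x y = a y x" for x y using sym by (auto simp: a_def)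
  have row: "(\<Sum>y\<in>T. a x y * (F x * (F x - F y))) = 0" if "x \<in> T" for x
  proof (cases "x \<in> V")
    case True
    have "(\<Sum>y\<in>T. a x y * (F x * (F x - F y))) = (\<Sum>y\<in>{y. A x y}. F x * (F x - F y))"
      using True fT by (intro sum.mono_neutral_cong_right) (auto simp: a_def T_def)
    also have "\<dots> = 0"
      using har[OF True] by (simp add: sum_distrib_left[symmetric] harmonic_at_def)
    finally show ?thesis .
  next
    case False
    then show ?thesis using FT that by simp
  qed
  \<comment> \<open>\<open>(F x - F y)\<^sup>2 = F x (F x - F y) + F y (F y - F x)\<close>; by symmetry both halves have the same sum.\<close>
  have "(\<Sum>x\<in>T. \<Sum>y\<in>T. a x y * (F x - F y)\<^sup>2) =
      (\<Sum>x\<in>T. \<Sum>y\<in>T. a x y * (F x * (F x - F y))) + (\<Sum>x\<in>T. \<Sum>y\<in>T. a x y * (F y * (F y - F x)))"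
    by (simp add: sum.distrib[symmetric] power2_eq_square algebra_simps)
  also have "(\<Sum>x\<in>T. \<Sum>y\<in>T. a x y * (F y * (F y - F x))) =
      (\<Sum>x\<in>T. \<Sum>y\<in>T. a x y * (F x * (F x - F y)))"
    by (subst sum.swap) (simp add: asym)
  also have "(\<Sum>x\<in>T. \<Sum>y\<in>T. a x y * (F x * (F x - F y))) = 0"
    using row by simp
  finally have "(\<Sum>x\<in>T. \<Sum>y\<in>T. a x y * (F x - F y)\<^sup>2) = 0" by simp
  moreover have "x \<in> T" "y \<in> T" using xy by (auto simp: T_def)
  moreover have nn: "0 \<le> a x y * (F x - F y)\<^sup>2" for x y by (simp add: a_def)
  ultimately have "a x y * (F x - F y)\<^sup>2 = 0"
    using fT by (simp add: sum_nonneg_eq_0_iff sum_nonneg)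
  then show ?thesis using xy by (simp add: a_def)
qed

text \<open>The set \<open>B\<close> contains the outer boundary of \<open>V\<close>, so the gradients of functions harmonic on
  \<open>V\<close> form a space of dimension at most \<open>\<bar>B\<bar>\<close>. The sum on the left is a sum of suprema, possibly
  approached by a different function for each \<open>x\<close>; the weights bound them simultaneously.\<close>

lemma sum_harmonic_share_in_le:
  fixes A :: "'a \<Rightarrow> 'a \<Rightarrow> bool"
  assumes sym: "\<And>x y. A x y \<Longrightarrow> A y x" and fV: "finite V" and fB: "finite B"
    and lf: "\<And>x. x \<in> V \<Longrightarrow> finite {y. A x y}"
    and B: "\<And>x y. x \<in> V \<Longrightarrow> y \<notin> V \<Longrightarrow> A x y \<Longrightarrow> y \<in> B"
  shows "(\<Sum>x\<in>V. harmonic_share_in A V x) \<le> of_nat (card B)"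
proof -
  define E where "E = (SIGMA x:V. {y. A x y})"
  define S where "S = {F. \<forall>x\<in>V. harmonic_at A F x}"
  define d :: "'a \<times> 'a \<Rightarrow> ('a \<Rightarrow> real) \<Rightarrow> real" where "d = (\<lambda>(x, y) F. F x - F y)"
  have fE: "finite E" using fV lf by (auto simp: E_def)
  have "\<exists>w. (\<forall>e\<in>E. 0 \<le> w e) \<and> (\<Sum>e\<in>E. w e) \<le> real (card B) \<and>
           (\<forall>F\<in>S. \<forall>e\<in>E. (d e F)\<^sup>2 \<le> w e * (\<Sum>e\<in>E. (d e F)\<^sup>2))"
  proof (rule coordinate_weights[OF fB fE])
    show "d e (\<lambda>x. F x + c * G x) = d e F + c * d e G" for e F G c
      by (simp add: d_def algebra_simps split: prod.splits)
    show "(\<lambda>x. F x + c * G x) \<in> S" if "F \<in> S" "G \<in> S" for F G c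
    proof -
      have "(\<Sum>y | A x y. (F x + c * G x) - (F y + c * G y)) =
          (\<Sum>y | A x y. F x - F y) + c * (\<Sum>y | A x y. G x - G y)" for x
        by (simp add: sum_distrib_left sum.distrib[symmetric] algebra_simps)
      then show ?thesis using that by (simp add: S_def harmonic_at_def)
    qed
    show "d e F = 0" if "F \<in> S" "\<forall>b\<in>B. F b = 0" "e \<in> E" for F e
      using that harmonic_zero_outside[of A V F] sym fV lf B
      by (fastforce simp: d_def E_def S_def)
  qed
  then obtain w where w0: "\<And>e. e \<in> E \<Longrightarrow> 0 \<le> w e" and tr: "(\<Sum>e\<in>E. w e) \<le> real (card B)"
    and we: "\<And>F e. F \<in> S \<Longrightarrow> e \<in> E \<Longrightarrow> (d e F)\<^sup>2 \<le> w e * (\<Sum>e\<in>E. (d e F)\<^sup>2)"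
    by blast
  have "harmonic_share_in A V x \<le> ennreal (\<Sum>y | A x y. w (x, y))" if x: "x \<in> V" for x
    unfolding harmonic_share_in_def
  proof (rule SUP_least, rule ennreal_leI)
    fix F assume F: "F \<in> normalized_harmonic A V"
    have en: "(\<Sum>e\<in>E. (d e F)\<^sup>2) = (\<Sum>x\<in>V. star_energy A F x)"
      using fV lf by (simp add: E_def d_def star_energy_def sum.Sigma split_def)
    have "(F x - F y)\<^sup>2 \<le> w (x, y)" if "A x y" for y
    proof -
      have e: "(x, y) \<in> E" using x that by (simp add: E_def)
      have "(F x - F y)\<^sup>2 \<le> w (x, y) * (\<Sum>x\<in>V. star_energy A F x)"
        using we[OF _ e, of F] F en by (simp add: S_def normalized_harmonic_def d_def)
      also have "\<dots> \<le> w (x, y) * 1"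
        using F w0[OF e] by (intro mult_left_mono) (auto simp: normalized_harmonic_def)
      finally show ?thesis by simp
    qed
    then show "star_energy A F x \<le> (\<Sum>y | A x y. w (x, y))"
      unfolding star_energy_def by (intro sum_mono) auto
  qed
  then have "(\<Sum>x\<in>V. harmonic_share_in A V x) \<le> (\<Sum>x\<in>V. ennreal (\<Sum>y | A x y. w (x, y)))"
    by (rule sum_mono)
  also have "\<dots> = ennreal (\<Sum>x\<in>V. \<Sum>y | A x y. w (x, y))"
    using w0 by (intro sum_ennreal) (auto simp: E_def intro!: sum_nonneg)
  also have "(\<Sum>x\<in>V. \<Sum>y | A x y. w (x, y)) = (\<Sum>e\<in>E. w e)"
    using fV lf by (simp add: E_def sum.Sigma)
  also have "ennreal (\<Sum>e\<in>E. w e) \<le> of_nat (card B)"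
    using tr by (metis ennreal_leI ennreal_of_nat_eq_real_of_nat)
  finally show ?thesis .
qed

lemma harmonic_share_in_cong:
  assumes "\<And>u. u \<in> V \<Longrightarrow> A u = A' u" and "x \<in> V"
  shows "harmonic_share_in A V x = harmonic_share_in A' V x"
proof -
  have se: "star_energy A F u = star_energy A' F u" if "u \<in> V" for F u
    using assms(1)[OF that] by (simp add: star_energy_def)
  have "harmonic_at A F u = harmonic_at A' F u" if "u \<in> V" for F u
    using assms(1)[OF that] by (simp add: harmonic_at_def)
  then have "normalized_harmonic A V = normalized_harmonic A' V"
    unfolding normalized_harmonic_def using se by (intro Collect_cong conj_cong) simp_all
  then show ?thesis by (simp add: harmonic_share_in_def se assms(2))
qed

text \<open>Competitors pull back along the isomorphism \<open>\<gamma>\<close>. One inequality suffices in the sequel,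
  because transitivity moves every vertex to every other.\<close>

lemma harmonic_share_image_le:
  assumes inj: "inj_on \<gamma> X" and im: "\<gamma> ` X = X"
    and A': "\<And>u v. A' u v \<Longrightarrow> v \<in> X"
    and A: "\<And>u v. A u v \<Longrightarrow> v \<in> X"
    and iso: "\<And>u v. u \<in> X \<Longrightarrow> v \<in> X \<Longrightarrow> A' (\<gamma> u) (\<gamma> v) \<longleftrightarrow> A u v"
    and x: "x \<in> X"
  shows "harmonic_share A' X (\<gamma> x) \<le> harmonic_share A X x"
proof -
  have N: "{y. A' (\<gamma> u) y} = \<gamma> ` {y. A u y}" if "u \<in> X" for u
    using A A' iso that im by (auto simp: image_iff set_eq_iff) (metis imageE)
  have injN: "inj_on \<gamma> {y. A u y}" for u
    using inj A by (auto intro: inj_on_subset)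
  have se: "star_energy A' F (\<gamma> u) = star_energy A (F \<circ> \<gamma>) u" if "u \<in> X" for F u
    by (simp add: star_energy_def N[OF that] sum.reindex[OF injN])
  have ha: "harmonic_at A' F (\<gamma> u) = harmonic_at A (F \<circ> \<gamma>) u" if "u \<in> X" for F u
    by (simp add: harmonic_at_def N[OF that] sum.reindex[OF injN])
  have le: "harmonic_share_in A' (\<gamma> ` V) (\<gamma> x) \<le> harmonic_share_in A V x"
    if V: "V \<subseteq> X" for V
    unfolding harmonic_share_in_def
  proof (rule SUP_least)
    fix F assume F: "F \<in> normalized_harmonic A' (\<gamma> ` V)"
    have "inj_on \<gamma> V" using inj V by (rule inj_on_subset)
    then have "(\<Sum>x\<in>\<gamma> ` V. star_energy A' F x) = (\<Sum>x\<in>V. star_energy A (F \<circ> \<gamma>) x)"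
      using V by (auto simp: sum.reindex se intro!: sum.cong)
    then have "F \<circ> \<gamma> \<in> normalized_harmonic A V"
      using F V ha by (auto simp: normalized_harmonic_def)
    then show "ennreal (star_energy A' F (\<gamma> x))
        \<le> (SUP F\<in>normalized_harmonic A V. ennreal (star_energy A F x))"
      unfolding se[OF x] by (rule SUP_upper)
  qed
  show ?thesis
    unfolding harmonic_share_def
  proof (rule INF_greatest)
    fix V assume V: "V \<in> {V. finite V \<and> V \<subseteq> X \<and> x \<in> V}"
    then have "\<gamma> ` V \<in> {V. finite V \<and> V \<subseteq> X \<and> \<gamma> x \<in> V}" using im by auto
    then have "(INF V\<in>{V. finite V \<and> V \<subseteq> X \<and> \<gamma> x \<in> V}. harmonic_share_in A' V (\<gamma> x))
        \<le> harmonic_share_in A' (\<gamma> ` V) (\<gamma> x)"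
      by (rule INF_lower)
    also have "\<dots> \<le> harmonic_share_in A V x" using le V by simp
    finally show "(INF V\<in>{V. finite V \<and> V \<subseteq> X \<and> \<gamma> x \<in> V}. harmonic_share_in A' V (\<gamma> x))
        \<le> harmonic_share_in A V x" .
  qed
qed

text \<open>A single function of finite total energy, divided by the square root of that energy,
  is admissible for all finite \<open>V\<close> and so bounds the infimum from below.\<close>

lemma harmonic_share_pos:
  assumes har: "\<And>x. x \<in> X \<Longrightarrow> harmonic_at A F x"
    and bd: "\<And>V. finite V \<Longrightarrow> V \<subseteq> X \<Longrightarrow> (\<Sum>x\<in>V. star_energy A F x) \<le> D"
    and x: "x \<in> X" and pos: "0 < star_energy A F x"
  shows "0 < harmonic_share A X x"
proof -
  have "star_energy A F x \<le> D" using bd[of "{x}"] x by simp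
  with pos have D: "D > 0" by simp
  define G where "G = (\<lambda>x. F x / sqrt D)"
  have "(F u / sqrt D - F y / sqrt D)\<^sup>2 = (F u - F y)\<^sup>2 / D" for u y
    using D by (simp add: diff_divide_distrib[symmetric] power_divide)
  then have se: "star_energy A G u = star_energy A F u / D" for u
    by (simp add: star_energy_def G_def sum_divide_distrib[symmetric])
  have ha: "harmonic_at A G u" if "u \<in> X" for u
    using har[OF that]
    by (simp add: harmonic_at_def G_def diff_divide_distrib[symmetric] sum_divide_distrib[symmetric])
  have "ennreal (star_energy A G x) \<le> harmonic_share A X x"
    unfolding harmonic_share_def harmonic_share_in_def
  proof (intro INF_greatest SUP_upper)
    fix V assume V: "V \<in> {V. finite V \<and> V \<subseteq> X \<and> x \<in> V}"
    then show "G \<in> normalized_harmonic A V"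
      using bd[of V] D ha by (auto simp: normalized_harmonic_def se sum_divide_distrib[symmetric])
  qed
  moreover have "0 < ennreal (star_energy A G x)" using pos D by (simp add: se)
  ultimately show ?thesis by (rule less_le_trans[rotated])
qed

section \<open>Expected shares in an invariant percolation\<close>

text \<open>Both endpoints are required to be open, so that the relation is symmetric even for
  configurations in which an open edge has a closed endpoint.\<close>

definition config_adj :: "'a ugraph \<Rightarrow> 'a config \<Rightarrow> 'a \<Rightarrow> 'a \<Rightarrow> bool" where
  "config_adj G \<omega> x y \<longleftrightarrow>
     x \<in> verts (config_graph G \<omega>) \<and> y \<in> nbrs (config_graph G \<omega>) x"

lemma config_adj_iff:
  "config_adj G \<omega> x y \<longleftrightarrow> x \<in> verts G \<and> y \<in> verts G \<and> {x, y} \<in> edges G \<and>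
     \<omega> (Inl x) \<and> \<omega> (Inl y) \<and> \<omega> (Inr {x, y})"
  by (auto simp: config_adj_def config_graph_def nbrs_def)

lemma config_adj_sym: "config_adj G \<omega> x y \<Longrightarrow> config_adj G \<omega> y x"
  by (simp add: config_adj_iff insert_commute)

lemma config_adj_nbrs: "{y. config_adj G \<omega> x y} \<subseteq> nbrs G x"
  by (auto simp: config_adj_iff nbrs_def)

text \<open>Only finitely many patterns on \<open>J\<close> exist, so every preimage is a finite union of
  cylinders.\<close>

lemma measurable_finitely_many_coordinates:
  fixes f :: "('i \<Rightarrow> bool) \<Rightarrow> 'b"
  assumes J: "finite J" "J \<subseteq> I"
    and sp: "space N = UNIV"
    and dep: "\<And>\<omega> \<omega>'. (\<And>j. j \<in> J \<Longrightarrow> \<omega> j = \<omega>' j) \<Longrightarrow> f \<omega> = f \<omega>'"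
  shows "f \<in> measurable (PiM I (\<lambda>_. count_space UNIV)) N"
proof (rule measurableI)
  let ?M = "PiM I (\<lambda>_. count_space (UNIV :: bool set))"
  fix A
  define K where "K = {\<eta> \<in> J \<rightarrow>\<^sub>E UNIV. f \<eta> \<in> A}"
  have fK: "finite K" using finite_PiE[OF J(1), of "\<lambda>_. UNIV :: bool set"] by (auto simp: K_def)
  have eq: "f -` A \<inter> space ?M = (\<Union>\<eta>\<in>K. {\<omega> \<in> space ?M. \<forall>j\<in>J. \<omega> j = \<eta> j})"
  proof (intro equalityI subsetI)
    fix \<omega> assume \<omega>: "\<omega> \<in> f -` A \<inter> space ?M"
    have "f (restrict \<omega> J) = f \<omega>" by (rule dep) simp
    then have "restrict \<omega> J \<in> K" using \<omega> by (simp add: K_def)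
    then show "\<omega> \<in> (\<Union>\<eta>\<in>K. {\<omega> \<in> space ?M. \<forall>j\<in>J. \<omega> j = \<eta> j})"
      using \<omega> by (intro UN_I[of "restrict \<omega> J"]) simp_all
  next
    fix \<omega> assume "\<omega> \<in> (\<Union>\<eta>\<in>K. {\<omega> \<in> space ?M. \<forall>j\<in>J. \<omega> j = \<eta> j})"
    then obtain \<eta> where \<eta>: "\<eta> \<in> K" "\<omega> \<in> space ?M" "\<And>j. j \<in> J \<Longrightarrow> \<omega> j = \<eta> j" by blast
    then show "\<omega> \<in> f -` A \<inter> space ?M" using dep[of \<omega> \<eta>] by (simp add: K_def)
  qed
  have "{\<omega> \<in> space ?M. \<omega> j = \<eta> j} \<in> sets ?M" if "j \<in> J" for j \<eta>
  proof -
    have "(\<lambda>\<omega>. \<omega> j) \<in> measurable ?M (count_space UNIV)"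
      using that J(2) by (intro measurable_component_singleton) auto
    from measurable_sets[OF this, of "{\<eta> j}"] show ?thesis
      by (simp add: vimage_def Int_def conj_commute)
  qed
  then have "{\<omega> \<in> space ?M. \<forall>j\<in>J. \<omega> j = \<eta> j} \<in> sets ?M" for \<eta>
    by (intro sets.sets_Collect_finite_All J(1)) auto
  then show "f -` A \<inter> space ?M \<in> sets ?M"
    unfolding eq using fK by (intro sets.finite_UN) auto
qed (simp add: sp)

text \<open>The share in a finite \<open>V\<close> sees only the vertices in or next to \<open>V\<close> and the edges meeting \<open>V\<close>, and
  the infimum runs over countably many sets \<open>V\<close>.\<close>

lemma harmonic_share_measurable:
  assumes lf: "locally_finite G" and ct: "countable (verts G)" and x: "x \<in> verts G"
  shows "(\<lambda>\<omega>. harmonic_share (config_adj G \<omega>) (verts G) x) \<in> borel_measurable (config_space G)"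
  unfolding harmonic_share_def
proof (rule borel_measurable_INF)
  have "{V. finite V \<and> V \<subseteq> verts G \<and> x \<in> V} \<subseteq> {V. finite V \<and> V \<subseteq> verts G}" by auto
  then show "countable {V. finite V \<and> V \<subseteq> verts G \<and> x \<in> V}"
    using countable_Collect_finite_subset[OF ct] countable_subset by blast
next
  fix V assume V: "V \<in> {V. finite V \<and> V \<subseteq> verts G \<and> x \<in> V}"
  define P where "P = (SIGMA u:V. nbrs G u)"
  define J where "J = Inl ` V \<union> (\<lambda>(u, v). Inl v) ` P \<union> (\<lambda>(u, v). Inr {u, v}) ` P"
  have "finite P" using V lf by (auto simp: P_def locally_finite_def)
  then have J: "finite J" "J \<subseteq> verts G <+> edges G"
    using V by (auto simp: J_def P_def nbrs_def)
  show "(\<lambda>\<omega>. harmonic_share_in (config_adj G \<omega>) V x) \<in> borel_measurable (config_space G)"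
    unfolding config_space_def
  proof (rule measurable_finitely_many_coordinates[OF J])
    fix \<omega> \<omega>' :: "'a config" assume eq: "\<And>j. j \<in> J \<Longrightarrow> \<omega> j = \<omega>' j"
    have "config_adj G \<omega> u v = config_adj G \<omega>' u v" if u: "u \<in> V" for u v
    proof (cases "v \<in> nbrs G u")
      case True
      then have "Inl u \<in> J" "Inl v \<in> J" "Inr {u, v} \<in> J"
        using u by (force simp: J_def P_def)+
      then show ?thesis by (simp add: config_adj_iff eq)
    next
      case False
      then show ?thesis by (auto simp: config_adj_iff nbrs_def)
    qed
    then show "harmonic_share_in (config_adj G \<omega>) V x = harmonic_share_in (config_adj G \<omega>') V x"
      using V by (intro harmonic_share_in_cong) auto
  qed simp
qed

lemma is_graph_edgeE:
  assumes "is_graph G" "e \<in> edges G"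
  obtains u v where "e = {u, v}" "u \<in> verts G" "v \<in> verts G" "u \<noteq> v"
proof -
  have "card e = 2" "e \<subseteq> verts G" using assms by (auto simp: is_graph_def)
  moreover from this obtain u v where "e = {u, v}" "u \<noteq> v" by (auto simp: card_2_iff)
  ultimately show thesis using that by blast
qed

lemma graph_aut_inv_into:
  assumes "\<gamma> \<in> graph_auts G" "is_graph G"
  shows "\<And>v. v \<in> verts G \<Longrightarrow> inv_into (verts G) \<gamma> v \<in> verts G"
    and "\<And>e. e \<in> edges G \<Longrightarrow> inv_into (verts G) \<gamma> ` e \<in> edges G"
proof -
  let ?d = "inv_into (verts G) \<gamma>"
  have bij: "bij_betw \<gamma> (verts G) (verts G)"
    using assms(1) by (simp add: graph_auts_def Bij_def)
  show d: "?d v \<in> verts G" if "v \<in> verts G" for v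
    using that bij by (metis bij_betw_def inv_into_into)
  show "?d ` e \<in> edges G" if eG: "e \<in> edges G" for e
  proof -
    obtain u v where e: "e = {u, v}" "u \<in> verts G" "v \<in> verts G"
      using assms(2) eG by (rule is_graph_edgeE)
    then have "{\<gamma> (?d u), \<gamma> (?d v)} \<in> edges G"
      using bij eG by (simp add: bij_betw_inv_into_right)
    then show ?thesis using assms(1) d e by (simp add: graph_auts_def)
  qed
qed

lemma config_image_measurable:
  assumes "\<gamma> \<in> graph_auts G" "is_graph G"
  shows "config_image G \<gamma> \<in> measurable (config_space G) (config_space G)"
  unfolding config_image_def config_space_def Let_def
proof (rule measurable_restrict)
  fix z assume "z \<in> verts G <+> edges G"
  then have "map_sum (inv_into (verts G) \<gamma>) ((`) (inv_into (verts G) \<gamma>)) z \<in> verts G <+> edges G"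
    using graph_aut_inv_into[OF assms] by auto
  then show "(\<lambda>\<omega>. \<omega> (map_sum (inv_into (verts G) \<gamma>) ((`) (inv_into (verts G) \<gamma>)) z))
      \<in> measurable (PiM (verts G <+> edges G) (\<lambda>_. count_space UNIV)) (count_space UNIV)"
    by (rule measurable_component_singleton)
qed

lemma config_adj_image:
  assumes "\<gamma> \<in> graph_auts G" "u \<in> verts G" "v \<in> verts G"
  shows "config_adj G (config_image G \<gamma> \<omega>) (\<gamma> u) (\<gamma> v) \<longleftrightarrow> config_adj G \<omega> u v"
proof -
  have bij: "bij_betw \<gamma> (verts G) (verts G)"
    using assms(1) by (simp add: graph_auts_def Bij_def)
  then have "\<gamma> u \<in> verts G" "\<gamma> v \<in> verts G"
      "inv_into (verts G) \<gamma> (\<gamma> u) = u" "inv_into (verts G) \<gamma> (\<gamma> v) = v"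
    using assms by (auto simp: bij_betw_def)
  then show ?thesis
    using assms by (auto simp: config_adj_iff config_image_def Let_def graph_auts_def)
qed

lemma expected_harmonic_share_le:
  assumes G: "is_graph G" "locally_finite G" "countable (verts G)"
    and \<mu>: "invariant_percolation G \<Gamma> \<mu>"
    and \<gamma>: "\<gamma> \<in> \<Gamma>" "\<gamma> \<in> graph_auts G" and x: "x \<in> verts G"
  shows "(\<integral>\<^sup>+\<omega>. harmonic_share (config_adj G \<omega>) (verts G) (\<gamma> x) \<partial>\<mu>)
      \<le> (\<integral>\<^sup>+\<omega>. harmonic_share (config_adj G \<omega>) (verts G) x \<partial>\<mu>)"
proof -
  have bij: "bij_betw \<gamma> (verts G) (verts G)"
    using \<gamma>(2) by (simp add: graph_auts_def Bij_def)
  then have gx: "\<gamma> x \<in> verts G" using x by (auto simp: bij_betw_def)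
  have s: "sets \<mu> = sets (config_space G)"
    and inv: "distr \<mu> (config_space G) (config_image G \<gamma>) = \<mu>"
    using \<mu> \<gamma>(1) by (auto simp: invariant_percolation_def percolation_def)
  have m: "config_image G \<gamma> \<in> measurable \<mu> (config_space G)"
    using config_image_measurable[OF \<gamma>(2) G(1)] measurable_cong_sets[OF s refl] by blast
  have "(\<integral>\<^sup>+\<omega>. harmonic_share (config_adj G \<omega>) (verts G) (\<gamma> x) \<partial>\<mu>) =
      (\<integral>\<^sup>+\<omega>. harmonic_share (config_adj G \<omega>) (verts G) (\<gamma> x)
        \<partial>distr \<mu> (config_space G) (config_image G \<gamma>))"
    by (simp add: inv)
  also have "\<dots> = (\<integral>\<^sup>+\<omega>. harmonic_share (config_adj G (config_image G \<gamma> \<omega>)) (verts G) (\<gamma> x) \<partial>\<mu>)"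
    using harmonic_share_measurable[OF G(2,3) gx] by (simp add: nn_integral_distr[OF m])
  also have "\<dots> \<le> (\<integral>\<^sup>+\<omega>. harmonic_share (config_adj G \<omega>) (verts G) x \<partial>\<mu>)"
  proof (rule nn_integral_mono)
    fix \<omega>
    show "harmonic_share (config_adj G (config_image G \<gamma> \<omega>)) (verts G) (\<gamma> x)
        \<le> harmonic_share (config_adj G \<omega>) (verts G) x"
      using bij x config_adj_image[OF \<gamma>(2)]
      by (intro harmonic_share_image_le) (auto simp: bij_betw_def config_adj_iff)
  qed
  finally show ?thesis .
qed

text \<open>The infimum in the share is bounded by its value at this particular \<open>V\<close>. The outer vertex
  boundary injects into the edge boundary: each boundary vertex chooses an edge leading
  into \<open>V\<close>, and it is the only endpoint of that edge outside \<open>V\<close>.\<close>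

lemma sum_harmonic_share_le_boundary:
  assumes G: "is_graph G" "locally_finite G" and V: "finite V" "V \<subseteq> verts G"
  shows "(\<Sum>x\<in>V. harmonic_share (config_adj G \<omega>) (verts G) x)
      \<le> of_nat (card (edge_boundary G V))"
proof -
  define B where "B = (\<Union>x\<in>V. nbrs G x) - V"
  have fN: "finite (\<Union>x\<in>V. nbrs G x)" using G(2) V by (auto simp: locally_finite_def)
  then have fB: "finite B" by (simp add: B_def)
  have "edge_boundary G V \<subseteq> (\<lambda>(x, y). {x, y}) ` (SIGMA x:V. nbrs G x)"
  proof
    fix e assume e: "e \<in> edge_boundary G V"
    then have e': "e \<in> edges G" "card (e \<inter> V) = 1" by (auto simp: edge_boundary_def)
    obtain x where x: "e \<inter> V = {x}" using e'(2) by (auto simp: card_1_singleton_iff)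
    obtain u v where uv: "e = {u, v}" "u \<in> verts G" "v \<in> verts G"
      using G(1) e'(1) by (rule is_graph_edgeE)
    have "x = u \<or> x = v" using x uv(1) by auto
    then obtain y where y: "e = {x, y}" "y \<in> verts G"
    proof
      assume "x = u"
      then show thesis using that[of v] uv by simp
    next
      assume "x = v"
      then show thesis using that[of u] uv by (simp add: insert_commute)
    qed
    have "x \<in> V" using x by blast
    moreover have "y \<in> nbrs G x" using y e'(1) by (simp add: nbrs_def)
    ultimately show "e \<in> (\<lambda>(x, y). {x, y}) ` (SIGMA x:V. nbrs G x)"
      using y(1) by (intro image_eqI[of _ _ "(x, y)"]) simp_all
  qed
  moreover have "finite (SIGMA x:V. nbrs G x)"
    using V G(2) by (auto simp: locally_finite_def)
  ultimately have fE: "finite (edge_boundary G V)"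
    using finite_subset by blast
  have "\<exists>x\<in>V. y \<in> nbrs G x" if "y \<in> B" for y using that by (auto simp: B_def)
  then obtain p where p: "\<And>y. y \<in> B \<Longrightarrow> p y \<in> V \<and> y \<in> nbrs G (p y)" by metis
  have "card B \<le> card (edge_boundary G V)"
  proof (rule card_inj_on_le[OF _ _ fE])
    show "inj_on (\<lambda>y. {p y, y}) B"
      using p by (intro inj_onI) (auto simp: doubleton_eq_iff B_def)
    have "{p y, y} \<inter> V = {p y}" if "y \<in> B" for y using p[OF that] that by (auto simp: B_def)
    then have "card ({p y, y} \<inter> V) = 1" if "y \<in> B" for y using that by simp
    then show "(\<lambda>y. {p y, y}) ` B \<subseteq> edge_boundary G V"
      using p unfolding edge_boundary_def nbrs_def by blast
  qed
  have "(\<Sum>x\<in>V. harmonic_share (config_adj G \<omega>) (verts G) x)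
      \<le> (\<Sum>x\<in>V. harmonic_share_in (config_adj G \<omega>) V x)"
    unfolding harmonic_share_def using V by (intro sum_mono INF_lower) auto
  also have "\<dots> \<le> of_nat (card B)"
  proof (rule sum_harmonic_share_in_le[OF config_adj_sym V(1) fB])
    show "finite {y. config_adj G \<omega> x y}" if "x \<in> V" for x
      using config_adj_nbrs[of G \<omega> x] G(2) V(2) that
      by (auto simp: locally_finite_def intro: finite_subset)
    show "y \<in> B" if "x \<in> V" "y \<notin> V" "config_adj G \<omega> x y" for x y
      using that config_adj_nbrs[of G \<omega> x] by (auto simp: B_def)
  qed
  also have "\<dots> \<le> of_nat (card (edge_boundary G V))"
    using \<open>card B \<le> card (edge_boundary G V)\<close> by simp
  finally show ?thesis .
qed

text \<open>The expected share is at most the boundary ratio of every Foelner set containing \<open>x\<close>.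
  The Foelner sets also exhibit the vertex set as countable, which lets the exceptional null
  sets of all vertices be united.\<close>

lemma AE_harmonic_share_zero:
  assumes G: "is_graph G" "locally_finite G" "amenable_graph G"
    and \<Gamma>: "subgroup \<Gamma> (aut_group G)" "transitive_on_verts G \<Gamma>"
    and \<mu>: "invariant_percolation G \<Gamma> \<mu>"
  shows "AE \<omega> in \<mu>. \<forall>x\<in>verts G. harmonic_share (config_adj G \<omega>) (verts G) x = 0"
proof -
  obtain W :: "nat \<Rightarrow> 'a set" where W: "\<And>n. finite (W n)" "\<And>n. W n \<subseteq> verts G"
      "incseq W" "(\<Union>n. W n) = verts G"
      and lim: "(\<lambda>n. real (card (edge_boundary G (W n))) / real (card (W n))) \<longlonglongrightarrow> 0"
    using G(3) unfolding amenable_graph_def by (elim exE conjE) (auto intro: that)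
  have "countable (\<Union>n. W n)" using W(1) by (auto intro: countable_finite)
  then have ct: "countable (verts G)" by (simp add: W(4))
  interpret prob_space \<mu>
    using \<mu> by (simp add: invariant_percolation_def percolation_def)
  have s: "sets \<mu> = sets (config_space G)"
    using \<mu> by (simp add: invariant_percolation_def percolation_def)
  define h where "h x \<omega> = harmonic_share (config_adj G \<omega>) (verts G) x" for x \<omega>
  have hm: "h x \<in> borel_measurable \<mu>" if "x \<in> verts G" for x
    using harmonic_share_measurable[OF G(2) ct that] measurable_cong_sets[OF s refl]
    unfolding h_def by blast
  have auts: "\<Gamma> \<subseteq> graph_auts G"
    using subgroup.subset[OF \<Gamma>(1)] by (simp add: aut_group_def)
  have int0: "(\<integral>\<^sup>+\<omega>. h x \<omega> \<partial>\<mu>) = 0" if x: "x \<in> verts G" for x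
  proof -
    let ?c = "\<integral>\<^sup>+\<omega>. h x \<omega> \<partial>\<mu>"
    obtain m where m: "x \<in> W m" using x W(4) by blast
    have "?c \<le> ennreal (real (card (edge_boundary G (W n))) / real (card (W n)))" if "n \<ge> m" for n
    proof -
      have "x \<in> W n" using m W(3) that by (auto simp: incseq_def)
      then have pos: "card (W n) > 0" using W(1) by (auto simp: card_gt_0_iff)
      have "?c \<le> (\<integral>\<^sup>+\<omega>. h y \<omega> \<partial>\<mu>)" if "y \<in> W n" for y
      proof -
        have y: "y \<in> verts G" using that W(2) by blast
        obtain \<gamma> where "\<gamma> \<in> \<Gamma>" "\<gamma> y = x"
          using \<Gamma>(2) x y by (auto simp: transitive_on_verts_def)
        then show ?thesis
          using expected_harmonic_share_le[OF G(1,2) ct \<mu> _ _ y] auts by (auto simp: h_def)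
      qed
      then have "(\<Sum>y\<in>W n. ?c) \<le> (\<Sum>y\<in>W n. \<integral>\<^sup>+\<omega>. h y \<omega> \<partial>\<mu>)"
        by (rule sum_mono)
      also have "\<dots> = (\<integral>\<^sup>+\<omega>. (\<Sum>y\<in>W n. h y \<omega>) \<partial>\<mu>)"
        using W(2) hm by (subst nn_integral_sum) auto
      also have "\<dots> \<le> (\<integral>\<^sup>+\<omega>. of_nat (card (edge_boundary G (W n))) \<partial>\<mu>)"
        unfolding h_def
        by (intro nn_integral_mono sum_harmonic_share_le_boundary G W)
      also have "\<dots> = of_nat (card (edge_boundary G (W n)))"
        by (simp add: emeasure_space_1)
      finally have le: "of_nat (card (W n)) * ?c \<le> of_nat (card (edge_boundary G (W n)))" by simp
      have "?c = ?c * of_nat (card (W n)) / of_nat (card (W n))"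
        using pos by (intro mult_divide_eq_ennreal[symmetric]) auto
      also have "\<dots> \<le> of_nat (card (edge_boundary G (W n))) / of_nat (card (W n))"
        using le by (intro divide_right_mono_ennreal) (simp add: mult.commute)
      finally have "?c \<le> of_nat (card (edge_boundary G (W n))) / of_nat (card (W n))" .
      then show ?thesis
        using pos by (simp add: divide_ennreal ennreal_of_nat_eq_real_of_nat)
    qed
    moreover have "(\<lambda>n. ennreal (real (card (edge_boundary G (W n))) / real (card (W n))))
        \<longlonglongrightarrow> ennreal 0"
      using lim by (rule tendsto_ennrealI)
    ultimately have "?c \<le> ennreal 0"
      by (intro LIMSEQ_le_const) auto
    then show ?thesis by simp
  qed
  have "AE \<omega> in \<mu>. h x \<omega> = 0" if "x \<in> verts G" for x
    using nn_integral_0_iff_AE[OF hm[OF that]] int0[OF that] by simp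
  then show ?thesis
    using ct unfolding h_def by (simp add: AE_ball_countable)
qed

section \<open>Harmonic Dirichlet functions on components\<close>

lemma reachable_sym: "reachable H x y \<Longrightarrow> reachable H y x"
proof -
  have "sym ({(u, v). {u, v} \<in> edges H}\<^sup>*)"
    by (intro sym_rtrancl) (auto simp: sym_def insert_commute)
  then show "reachable H x y \<Longrightarrow> reachable H y x" by (auto simp: reachable_def sym_def)
qed

lemma reachable_in_component:
  assumes "reachable H x y"
  shows "reachable (component_of H x) x y"
  using assms unfolding reachable_def
proof (induction rule: rtrancl_induct)
  case (step y z)
  then have "{y, z} \<in> edges (component_of H x)"
    by (auto simp: component_of_def reachable_def intro: rtrancl_into_rtrancl)
  then show ?case using step.IH by (auto intro: rtrancl_into_rtrancl)
qed simp

lemma component_connected: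
  assumes "x \<in> verts H"
  shows "connected_graph (component_of H x)"
  unfolding connected_graph_def
proof (intro conjI ballI)
  show "verts (component_of H x) \<noteq> {}"
    using assms by (auto simp: component_of_def reachable_def)
  fix y z assume "y \<in> verts (component_of H x)" "z \<in> verts (component_of H x)"
  then have "reachable (component_of H x) x y" "reachable (component_of H x) x z"
    by (auto simp: component_of_def intro!: reachable_in_component[unfolded component_of_def])
  then show "reachable (component_of H x) y z"
    using reachable_sym[of "component_of H x" x y] by (auto simp: reachable_def)
qed

lemma component_nbrs:
  assumes "y \<in> verts (component_of H x)"
  shows "nbrs (component_of H x) y = nbrs H y"
  using assms
  by (auto simp: nbrs_def component_of_def reachable_def intro: rtrancl_into_rtrancl)

lemma connected_nonconstant_edge:
  assumes gr: "is_graph C" and con: "connected_graph C" and nc: "\<not> F constant_on verts C"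
  shows "\<exists>x\<in>verts C. \<exists>y\<in>nbrs C x. F x \<noteq> F y"
proof (rule ccontr)
  assume neg: "\<not> ?thesis"
  obtain o' where o': "o' \<in> verts C" using con by (auto simp: connected_graph_def)
  have "F y = F o'" if "y \<in> verts C" for y
  proof -
    have "(o', y) \<in> {(u, v). {u, v} \<in> edges C}\<^sup>*"
      using con o' that by (simp add: connected_graph_def reachable_def)
    then show ?thesis
    proof (induction rule: rtrancl_induct)
      case (step y z)
      then have "y \<in> verts C" "z \<in> nbrs C y" using gr by (auto simp: is_graph_def nbrs_def)
      then show ?case using neg step.IH by auto
    qed simp
  qed
  then show False using nc by (auto simp: constant_on_def)
qed

text \<open>A nonconstant harmonic Dirichlet function \<open>F\<close> on the component has positive energy at
  some vertex. Extended by \<open>0\<close> it is harmonic on the whole configuration with the same energy,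
  since no edge joins different components, and this contradicts the vanishing of the share
  there.\<close>

lemma component_in_O_HD:
  assumes lf: "locally_finite G" and gr: "is_graph (config_graph G \<omega>)"
    and zero: "\<And>x. x \<in> verts G \<Longrightarrow> harmonic_share (config_adj G \<omega>) (verts G) x = 0"
    and z: "z \<in> verts (config_graph G \<omega>)"
  shows "component_of (config_graph G \<omega>) z \<in> O_HD"
proof -
  let ?H = "config_graph G \<omega>"
  define C where "C = component_of ?H z"
  let ?A = "config_adj G \<omega>"
  have CV: "verts C \<subseteq> verts ?H" by (auto simp: C_def component_of_def)
  have HG: "verts ?H \<subseteq> verts G" by (auto simp: config_graph_def)
  have nbC: "nbrs C x = nbrs ?H x" if "x \<in> verts C" for x
    using component_nbrs that unfolding C_def by metis
  have nbA: "nbrs C x = {y. ?A x y}" if "x \<in> verts C" for x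
    using nbC[OF that] that CV by (auto simp: config_adj_def)
  have fin: "finite (nbrs C x)" if "x \<in> verts C" for x
  proof (rule finite_subset)
    show "nbrs C x \<subseteq> nbrs G x" using nbA[OF that] config_adj_nbrs[of G \<omega> x] by simp
    show "finite (nbrs G x)" using that lf CV HG by (auto simp: locally_finite_def)
  qed
  have 1: "is_graph C"
    using gr unfolding C_def is_graph_def component_of_def by auto
  have 2: "connected_graph C"
    unfolding C_def by (rule component_connected[OF z])
  have 3: "locally_finite C" using fin by (simp add: locally_finite_def)
  have "F constant_on verts C" if har: "harmonic C F" and dir: "dirichlet C F" for F
  proof (rule ccontr)
    assume "\<not> F constant_on verts C"
    then obtain x y where x: "x \<in> verts C" and y: "y \<in> nbrs C x" and ne: "F x \<noteq> F y"
      using connected_nonconstant_edge[OF 1 2] by blast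
    define K where "K = (\<lambda>u. if u \<in> verts C then F u else 0)"
    have step: "v \<in> verts C" if "?A u v" "u \<in> verts C" for u v
      using nbA[OF that(2)] that(1) by (auto simp: nbrs_def)
    have out: "v \<notin> verts C" if "?A u v" "u \<notin> verts C" for u v
      using step[OF config_adj_sym] that by blast
    have in_se: "star_energy ?A K u = (\<Sum>v\<in>nbrs C u. \<bar>F u - F v\<bar>\<^sup>2)" if "u \<in> verts C" for u
      unfolding star_energy_def nbA[OF that] using step that
      by (intro sum.cong) (auto simp: K_def)
    have out_se: "star_energy ?A K u = 0" if "u \<notin> verts C" for u
      unfolding star_energy_def using out that by (intro sum.neutral) (auto simp: K_def)
    have ha: "harmonic_at ?A K u" for u
    proof (cases "u \<in> verts C")
      case True
      have "(\<Sum>v | ?A u v. K u - K v) = (\<Sum>v\<in>nbrs C u. F u - F v)"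
        unfolding nbA[OF True] using step True by (intro sum.cong) (auto simp: K_def)
      also have "\<dots> = real (card (nbrs C u)) * F u - (\<Sum>v\<in>nbrs C u. F v)"
        by (simp add: sum_subtractf)
      also have "\<dots> = 0"
      proof (cases "nbrs C u = {}")
        case False
        then have "real (card (nbrs C u)) \<noteq> 0" using fin[OF True] by simp
        moreover have "F u = (\<Sum>v\<in>nbrs C u. F v) / real (card (nbrs C u))"
          using har True by (simp add: harmonic_def deg_def sum_divide_distrib)
        ultimately show ?thesis by (simp add: field_simps)
      qed simp
      finally show ?thesis by (simp add: harmonic_at_def)
    next
      case False
      then show ?thesis unfolding harmonic_at_def using out
        by (intro sum.neutral) (auto simp: K_def)
    qed
    define D where "D = (\<Sum>\<^sub>\<infinity>u\<in>verts C. \<Sum>v\<in>nbrs C u. \<bar>F u - F v\<bar>\<^sup>2)"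
    have "(\<Sum>u\<in>V. star_energy ?A K u) \<le> D" if "finite V" for V
    proof -
      have "(\<Sum>u\<in>V. star_energy ?A K u) = (\<Sum>u\<in>V \<inter> verts C. star_energy ?A K u)"
        using that out_se by (intro sum.mono_neutral_right) auto
      also have "\<dots> = (\<Sum>u\<in>V \<inter> verts C. \<Sum>v\<in>nbrs C u. \<bar>F u - F v\<bar>\<^sup>2)"
        using in_se by (intro sum.cong) auto
      also have "\<dots> \<le> D"
        unfolding D_def using dir that unfolding dirichlet_def
        by (intro finite_sum_le_infsum) (auto intro: sum_nonneg)
      finally show ?thesis .
    qed
    moreover have "0 < star_energy ?A K x"
    proof -
      have "0 < \<bar>F x - F y\<bar>\<^sup>2" using ne by simp
      also have "\<dots> \<le> (\<Sum>v\<in>nbrs C x. \<bar>F x - F v\<bar>\<^sup>2)"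
        using y fin[OF x] by (intro member_le_sum) auto
      finally show ?thesis using in_se[OF x] by simp
    qed
    moreover have "x \<in> verts G" using x CV HG by blast
    ultimately have "0 < harmonic_share ?A (verts G) x"
      using harmonic_share_pos[of "verts G" ?A K D x] ha by blast
    then show False using zero[OF \<open>x \<in> verts G\<close>] by simp
  qed
  then show ?thesis using 1 2 3 unfolding O_HD_def C_def[symmetric] by blast
qed

theorem theorem5p5:
  fixes G :: "'a ugraph" and \<Gamma> :: "('a \<Rightarrow> 'a) set" and \<mu> :: "'a config measure"
  assumes "is_graph G" and "connected_graph G" and "locally_finite G"
    and "amenable_graph G"
    and "subgroup \<Gamma> (aut_group G)" and "transitive_on_verts G \<Gamma>"
    and "invariant_percolation G \<Gamma> \<mu>"
  shows "AE \<omega> in \<mu>. \<forall>C \<in> components_of (config_graph G \<omega>). C \<in> O_HD"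
proof -
  have "AE \<omega> in \<mu>. is_graph (config_graph G \<omega>)"
    using assms(7) by (simp add: invariant_percolation_def percolation_def)
  with AE_harmonic_share_zero[OF assms(1,3-7)] show ?thesis
  proof eventually_elim
    case (elim \<omega>)
    then show ?case
      using component_in_O_HD[OF assms(3)] by (auto simp: components_of_def)
  qed
qed

end
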